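(* Let $p,n\ge 2$ and $n_1\ge 1$ be integers with $p\le n$ and $n_1\le n$, and let $k=2^{n-n_1}$. Let $G=K_{2^{n-p},2^{n-p},\ldots,2^{n-p}}$ be the complete $2^p$-partite graph on $2^n$ vertices, labeled by $1,\ldots,2^n$ so that its parts are the residue classes modulo $2^p$. Let $H=T_{n_1}^k$ be the $k$-rooted complete binary tree, formed from the $1$-rooted complete binary trees $T_{n_1}^{1,1},\ldots,T_{n_1}^{1,k}$ (in the order in which their roots are joined), where for each $1\le i\le k$ the vertices of $T_{n_1}^{1,i}$ are labeled by $(i-1)2^{n_1}+1,\ldots,i2^{n_1}$ according to the inorder traversal. Let $f:G\to H$ be the embedding that maps the vertex of $G$ labeled $x$ to the vertex of $H$ labeled $x$, for every $x$, and assigns to each edge $ab$ of $G$ a shortest path $P_f(ab)$ in $H$ between $f(a)$ and $f(b)$. Then $f$ has minimum wirelength among all embeddings of $G$ into $H$, and $$WL(G,H)=k\sum_{j=1}^{n_1}\sum_{i=1}^{2^{n_1-j}} c_j+\sum_{i=1}^{k-1} d_i,$$ where $$c_j=\begin{cases}(2^j-1)\bigl(2^{n-p}(2^p-1)-(2^j-2)\bigr), & j\le p,\\ (2^p-1)\bigl(2^{n-p}(2^j-1)-2^{j-p}(2^j-2)\bigr), & j>p,\end{cases}$$ $$d_i=\begin{cases} i2^{n_1}\bigl(2^{n-p}(2^p-1)-i2^{n_1}+1\bigr), & i2^{n_1}\le 2^p,\\ i2^{n_1-p}(2^p-1)\bigl(2^n-i2^{n_1}\bigr), & i2^{n_1}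>2^p.\end{cases}$$
   Context: All graphs are finite and simple. An embedding $f$ of a graph $G$ into a graph $H$ is an injective map $f:V(G)\to V(H)$ together with, for each edge $e=xy$ of $G$, a path $P_f(e)$ in $H$ between $f(x)$ and $f(y)$ (not necessarily shortest). Its wirelength $WL_f(G,H)$ is the sum over $e\in E(G)$ of the length of $P_f(e)$; equivalently, $\sum_{e\in E(H)}EC_f(e)$, where $EC_f(e)$ is the number of edges $e'$ of $G$ such that $e$ lies on $P_f(e')$. The wirelength of $G$ into $H$ is $WL(G,H)=\min_f WL_f(G,H)$, over all embeddings $f$ of $G$ into $H$. The complete $2^p$-partite graph $K_{2^{n-p},\ldots,2^{n-p}}$ has its vertex set partitioned into $2^p$ independent sets (parts), each of size $2^{n-p}$, with all possible edges between vertices in different parts. The complete binary tree $T_m$ is the rooted binary tree with $m$ levels, level $i$ ($1\le i\le m$) containing $2^{i-1}$ vertices, in which each internal vertex has exactly two children (left and right) and all leaves are on level $m$; it has $2^m-1$ vertices. The $1$-rooted complete binary tree $T_m^1$ is obtained from $T_m$ by attaching a pendant edge to its root; the new vertex is the root of $T_m^1$ (level $0$), and $T_m^1$ has $2^m$ vertices. The $k$-rooted complete binary tree $T_m^k$ is obtained from $k$ vertex-disjoint copies $T_m^{1,1},\ldots,T_m^{1,k}$ of $T_m^1$, with roots $r_1,\ldots,r_k$, by adding the edges $r_ir_{i+1}$, $1\le i\le k-1$. Inorder labeling of $T_m^1$: recursively, for each internal vertex of $T_m$, list the left subtree, then the vertex, then the right subtree; the root of $T_m^1$ is listed last.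
   Formalization: The formula for WL(G,H) is asserted only when p ≤ n_1 or p = n; for n_1 < p < n it is false, since the second case of d_i is then too small for some i (n=3, p=2, n_1=1: it gives 55, the true value is 56). Minimality of f is proved for all parameters. *)

theory Defs
  imports Complex_Main "HOL-Library.Tree"
begin

section \<open>Finite simple graphs, paths and embeddings\<close>

record 'a ugraph =
  verts :: "'a set"
  edges :: "'a set set"

definition simple_graph :: "'a ugraph \<Rightarrow> bool" where
  "simple_graph G \<longleftrightarrow>
     finite (verts G) \<and> (\<forall>e\<in>edges G. e \<subseteq> verts G \<and> card e = 2)"

definition path_between :: "'a ugraph \<Rightarrow> 'a \<Rightarrow> 'a \<Rightarrow> 'a list \<Rightarrow> bool" where
  "path_between H u v xs \<longleftrightarrow>
     xs \<noteq> [] \<and> hd xs = u \<and> last xs = v \<and> distinct xs \<and> set xs \<subseteq> verts H \<and>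
     successively (\<lambda>x y. {x, y} \<in> edges H) xs"

definition path_length :: "'a list \<Rightarrow> nat" where
  "path_length xs = length xs - 1"

definition shortest_path_between :: "'a ugraph \<Rightarrow> 'a \<Rightarrow> 'a \<Rightarrow> 'a list \<Rightarrow> bool" where
  "shortest_path_between H u v xs \<longleftrightarrow>
     path_between H u v xs \<and>
     (\<forall>ys. path_between H u v ys \<longrightarrow> path_length xs \<le> path_length ys)"

text \<open>
  An embedding is a vertex map \<open>f\<close> together with a routing \<open>P\<close>, which maps each (unordered) edge
  of \<open>G\<close> to a path of \<open>H\<close>; the path may be listed from either of its two ends. The values of
  \<open>f\<close> and \<open>P\<close> outside the vertices and edges of \<open>G\<close> are irrelevant.
\<close>

definition is_embedding ::
    "'a ugraph \<Rightarrow> 'b ugraph \<Rightarrow> ('a \<Rightarrow> 'b) \<Rightarrow> ('a set \<Rightarrow> 'b list) \<Rightarrow> bool" where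
  "is_embedding G H f P \<longleftrightarrow>
     inj_on f (verts G) \<and> f ` verts G \<subseteq> verts H \<and>
     (\<forall>e\<in>edges G. \<exists>x y. e = {x, y} \<and> path_between H (f x) (f y) (P e))"

definition shortest_routing ::
    "'a ugraph \<Rightarrow> 'b ugraph \<Rightarrow> ('a \<Rightarrow> 'b) \<Rightarrow> ('a set \<Rightarrow> 'b list) \<Rightarrow> bool" where
  "shortest_routing G H f P \<longleftrightarrow>
     (\<forall>e\<in>edges G. \<exists>x y. e = {x, y} \<and> shortest_path_between H (f x) (f y) (P e))"

text \<open>The wirelength of an embedding depends on its routing only.\<close>

definition embedding_wirelength :: "'a ugraph \<Rightarrow> ('a set \<Rightarrow> 'b list) \<Rightarrow> nat" where
  "embedding_wirelength G P = (\<Sum>e\<in>edges G. path_length (P e))"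

definition wirelength :: "'a ugraph \<Rightarrow> 'b ugraph \<Rightarrow> nat" where
  "wirelength G H =
     (LEAST w. \<exists>f P. is_embedding G H f P \<and> w = embedding_wirelength G P)"


section \<open>Complete multipartite graphs\<close>

text \<open>The parts are the fibres of \<open>part\<close> on \<open>V\<close>.\<close>

definition complete_multipartite :: "'a set \<Rightarrow> ('a \<Rightarrow> 'c) \<Rightarrow> 'a ugraph" where
  "complete_multipartite V part =
     \<lparr>verts = V, edges = {{x, y} | x y. x \<in> V \<and> y \<in> V \<and> part x \<noteq> part y}\<rparr>"

definition residue_multipartite :: "nat \<Rightarrow> nat \<Rightarrow> nat ugraph" where
  "residue_multipartite n p = complete_multipartite {1..2 ^ n} (\<lambda>x. x mod 2 ^ p)"

lemma simple_graph_complete_multipartite: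
  "finite V \<Longrightarrow> simple_graph (complete_multipartite V part)"
  by (auto simp: simple_graph_def complete_multipartite_def card_2_iff)


section \<open>Rooted complete binary trees\<close>

text \<open>
  \<open>binary_tree m\<close> is \<open>T\<^sub>m\<close>; each vertex is named by the sequence of left (\<open>False\<close>) and right
  (\<open>True\<close>) turns leading to it from the root.
\<close>

primrec binary_tree :: "nat \<Rightarrow> bool list tree" where
  "binary_tree 0 = \<langle>\<rangle>"
| "binary_tree (Suc m) =
     \<langle>map_tree (Cons False) (binary_tree m), [], map_tree (Cons True) (binary_tree m)\<rangle>"

primrec tree_edges :: "'a tree \<Rightarrow> 'a set set" where
  "tree_edges \<langle>\<rangle> = {}"
| "tree_edges \<langle>l, a, r\<rangle> =
     {{a, value t} | t. t \<in> {l, r} \<and> t \<noteq> \<langle>\<rangle>} \<union> tree_edges l \<union> tree_edges r"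

text \<open>
  \<open>T\<^sub>m\<^sup>1\<close>, for \<open>m \<ge> 1\<close>: the new root is \<open>None\<close>, and \<open>value (binary_tree m)\<close> is the root of \<open>T\<^sub>m\<close>.
\<close>

definition one_rooted_tree :: "nat \<Rightarrow> bool list option ugraph" where
  "one_rooted_tree m =
     \<lparr>verts = insert None (Some ` set_tree (binary_tree m)),
      edges = insert {None, Some (value (binary_tree m))}
                (image Some ` tree_edges (binary_tree m))\<rparr>"

text \<open>\<open>T\<^sub>m\<^sup>k\<close>: the first component of a vertex says in which of the \<open>k\<close> copies it lies.\<close>

definition k_rooted_tree :: "nat \<Rightarrow> nat \<Rightarrow> (nat \<times> bool list option) ugraph" where
  "k_rooted_tree m k =
     \<lparr>verts = {1..k} \<times> verts (one_rooted_tree m),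
      edges = (\<Union>i\<in>{1..k}. image (Pair i) ` edges (one_rooted_tree m)) \<union>
              {{(i, None), (i + 1, None)} | i. 1 \<le> i \<and> i < k}\<rparr>"

definition one_rooted_inorder :: "nat \<Rightarrow> bool list option list" where
  "one_rooted_inorder m = map Some (inorder (binary_tree m)) @ [None]"

text \<open>The vertex of \<open>T\<^sub>m\<^sup>k\<close> with label \<open>x\<close>, where \<open>1 \<le> x \<le> k 2\<^sup>m\<close>.\<close>

definition vertex_labeled :: "nat \<Rightarrow> nat \<Rightarrow> nat \<times> bool list option" where
  "vertex_labeled m x =
     ((x - 1) div 2 ^ m + 1, one_rooted_inorder m ! ((x - 1) mod 2 ^ m))"

lemma vertex_labeled_copy:
  assumes "1 \<le> i" "1 \<le> j" "j \<le> 2 ^ m"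
  shows "vertex_labeled m ((i - 1) * 2 ^ m + j) = (i, one_rooted_inorder m ! (j - 1))"
proof -
  obtain i' j' where "i = Suc i'" "j = Suc j'"
    using assms by (metis One_nat_def Suc_le_D)
  with assms show ?thesis
    by (simp add: vertex_labeled_def)
qed

lemma height_binary_tree: "height (binary_tree m) = m"
  by (induction m) auto

lemma complete_map_tree: "complete (map_tree f t) = complete t"
  by (induction t) auto

lemma complete_binary_tree: "complete (binary_tree m)"
  by (induction m) (auto simp: complete_map_tree)

lemma distinct_inorder_binary_tree: "distinct (inorder (binary_tree m))"
  by (induction m) (auto simp: inorder_map distinct_map)

lemma length_one_rooted_inorder: "length (one_rooted_inorder m) = 2 ^ m"
proof -
  have "length (inorder (binary_tree m)) + 1 = 2 ^ m"
    using size_if_complete[OF complete_binary_tree, of m] by (simp add: height_binary_tree)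
  then show ?thesis
    by (simp add: one_rooted_inorder_def)
qed

lemma tree_edges_simple:
  assumes "distinct (inorder t)" "e \<in> tree_edges t"
  shows "e \<subseteq> set_tree t \<and> card e = 2"
  using assms
proof (induction t)
  case (Node l a r)
  have val: "value t \<in> set_tree t" if "t \<noteq> \<langle>\<rangle>" for t :: "'a tree"
    using that by (cases t) auto
  from Node.prems consider (root) t where "e = {a, value t}" "t \<in> {l, r}" "t \<noteq> \<langle>\<rangle>"
    | (left) "e \<in> tree_edges l" | (right) "e \<in> tree_edges r"
    by auto
  then show ?case
  proof cases
    case root
    then have "value t \<in> set_tree l \<union> set_tree r"
      using val by auto
    moreover have "a \<notin> set_tree l \<union> set_tree r"
      using Node.prems by simp
    ultimately have "a \<noteq> value t" "value t \<in> set_tree l \<union> set_tree r"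
      by metis+
    then show ?thesis
      using root by auto
  next
    case left
    then show ?thesis
      using Node.IH(1) Node.prems by auto
  next
    case right
    then show ?thesis
      using Node.IH(2) Node.prems by auto
  qed
qed simp

lemma simple_graph_k_rooted_tree:
  assumes "m \<ge> 1"
  shows "simple_graph (k_rooted_tree m k)"
proof -
  have root: "value (binary_tree m) \<in> set_tree (binary_tree m)"
    using assms by (cases m) auto
  have one: "e \<subseteq> verts (one_rooted_tree m) \<and> card e = 2" if "e \<in> edges (one_rooted_tree m)" for e
    using that root tree_edges_simple[OF distinct_inorder_binary_tree, of _ m]
    by (auto simp: one_rooted_tree_def card_image)
  have "card (Pair i ` e) = 2" if "card e = 2" for i :: nat and e :: "bool list option set"
    using that by (simp add: card_image inj_on_def)
  with one have copy: "Pair i ` e \<subseteq> {1..k} \<times> verts (one_rooted_tree m) \<and> card (Pair i ` e) = 2"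
    if "e \<in> edges (one_rooted_tree m)" "i \<in> {1..k}" for i e
    using that by blast
  have join: "{(i, None), (i + 1, None)} \<subseteq> {1..k} \<times> verts (one_rooted_tree m) \<and>
      card {(i, None :: bool list option), (i + 1, None)} = 2" if "1 \<le> i" "i < k" for i
    using that by (simp add: one_rooted_tree_def)
  have "finite (verts (k_rooted_tree m k))"
    by (simp add: k_rooted_tree_def one_rooted_tree_def)
  moreover have "e \<subseteq> verts (k_rooted_tree m k) \<and> card e = 2" if "e \<in> edges (k_rooted_tree m k)" for e
  proof -
    from that consider i e' where "e = Pair i ` e'" "e' \<in> edges (one_rooted_tree m)" "i \<in> {1..k}"
      | i where "e = {(i, None), (i + 1, None)}" "1 \<le> i" "i < k"
      unfolding k_rooted_tree_def by auto
    then show ?thesis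
    proof cases
      case 1
      then show ?thesis
        using copy unfolding k_rooted_tree_def by simp
    next
      case 2
      then show ?thesis
        using join unfolding k_rooted_tree_def by simp
    qed
  qed
  ultimately show ?thesis
    by (simp add: simple_graph_def)
qed


section \<open>The closed form of the wirelength\<close>

definition c_term :: "nat \<Rightarrow> nat \<Rightarrow> nat \<Rightarrow> real" where
  "c_term n p j =
     (if j \<le> p
      then (2 ^ j - 1) * (2 ^ (n - p) * (2 ^ p - 1) - (2 ^ j - 2))
      else (2 ^ p - 1) * (2 ^ (n - p) * (2 ^ j - 1) - 2 ^ (j - p) * (2 ^ j - 2)))"

text \<open>
  The exponent \<open>n\<^sub>1 - p\<close> may be negative, hence the integer power.
\<close>

definition d_term :: "nat \<Rightarrow> nat \<Rightarrow> nat \<Rightarrow> nat \<Rightarrow> real" where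
  "d_term n p n1 i =
     (if i * 2 ^ n1 \<le> 2 ^ p
      then real i * 2 ^ n1 * (2 ^ (n - p) * (2 ^ p - 1) - real i * 2 ^ n1 + 1)
      else real i * 2 powi (int n1 - int p) * (2 ^ p - 1) * (2 ^ n - real i * 2 ^ n1))"

text \<open>
  For \<open>n\<^sub>1 < p < n\<close>, the second case of \<open>d_term\<close> is too small: it is the number of edges
  leaving the first \<open>x = i 2\<^bsup>n\<^sub>1\<^esup>\<close> vertices only if these meet all parts equally, that is, if
  \<open>2\<^sup>p\<close> divides \<open>x\<close>, and this fails for instance for \<open>i = 2\<^bsup>p - n\<^sub>1\<^esup> + 1\<close>. With
  \<open>n = 3\<close>, \<open>p = 2\<close>, \<open>n\<^sub>1 = 1\<close> the closed form gives 55, whereas the wirelength is 56. The closed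
  form is therefore only claimed when \<open>p \<le> n\<^sub>1\<close> or \<open>p = n\<close>, which is exactly when it is correct.
\<close>

definition closed_form :: "nat \<Rightarrow> nat \<Rightarrow> nat \<Rightarrow> nat \<Rightarrow> real" where
  "closed_form n p n1 k =
     real k * (\<Sum>j = 1..n1. \<Sum>i = 1..(2::nat) ^ (n1 - j). c_term n p j)
       + (\<Sum>i = 1..k - 1. d_term n p n1 i)"

end

theory Submission
  imports Defs
begin

text \<open>
  Root the tree \<open>H\<close> at the last root \<open>(k, None)\<close> of the chain. Deleting the edge above a vertex \<open>c\<close>
  separates the set of descendants of \<open>c\<close> from the rest, so a path between \<open>u\<close> and \<open>v\<close> must use
  that edge whenever exactly one of \<open>u\<close>, \<open>v\<close> is a descendant of \<open>c\<close>, and a shortest path uses no other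
  edge. Exchanging the two summations, the wirelength of an embedding \<open>g\<close> is at least the sum over
  \<open>c\<close> of the number of edges of \<open>G\<close> leaving the preimage under \<open>g\<close> of the descendants of \<open>c\<close>, with
  equality for a shortest routing (\<open>sum_boundaries_le_wirelength\<close>, \<open>wirelength_shortest_routing\<close>).

  Since \<open>G\<close> and \<open>H\<close> have equally many vertices, \<open>g\<close> is a bijection and the size of each of these
  preimages does not depend on \<open>g\<close>. In a complete multipartite graph with parts of equal size \<open>q\<close>
  and \<open>N\<close> vertices, the number of edges leaving a set \<open>A\<close> of size \<open>s\<close> that meets part \<open>r\<close> in \<open>a\<^sub>r\<close>
  vertices is \<open>s (N - s) - q s + \<Sum>\<^sub>r a\<^sub>r\<^sup>2\<close>, which for given \<open>s\<close> is smallest when the \<open>a\<^sub>r\<close> differ by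
  at most one. Intervals of labels are balanced in this sense, because the parts are residue
  classes (\<open>min_boundary_le\<close>, \<open>card_boundary_interval\<close>).

  Finally, under the inorder labelling the descendants of every vertex form an interval: the inorder
  list visits each subtree in one block, and the descendants of a root \<open>(i, None)\<close> are the first \<open>i\<close>
  copies (\<open>descendants_interval\<close>). So all terms are minimized at once. A vertex of \<open>T\<^sub>m\<close> at height
  \<open>j\<close> contributes the minimum for \<open>s = 2\<^sup>j - 1\<close>, which is \<open>c\<^sub>j\<close>, and the root of the \<open>i\<close>-th copy
  the minimum for \<open>s = i 2\<^sup>m\<close>, which is \<open>d\<^sub>i\<close> if \<open>p \<le> m\<close> or \<open>p = n\<close>, and \<open>0\<close> for \<open>i = k\<close>.
\<close>

section \<open>Distances measured by cuts\<close>

definition boundary :: "'a ugraph \<Rightarrow> 'a set \<Rightarrow> 'a set set" where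
  "boundary G A = {e \<in> edges G. e \<inter> A \<noteq> {} \<and> \<not> e \<subseteq> A}"

definition separators :: "'c set \<Rightarrow> ('c \<Rightarrow> 'b set) \<Rightarrow> 'b \<Rightarrow> 'b \<Rightarrow> 'c set" where
  "separators C S u v = {c \<in> C. (u \<in> S c) \<noteq> (v \<in> S c)}"

lemma separators_commute: "separators C S u v = separators C S v u"
  by (auto simp: separators_def)

lemma separators_triangle: "separators C S u w \<subseteq> separators C S u v \<union> separators C S v w"
  by (auto simp: separators_def)

text \<open>
  The two conditions make \<open>C\<close> behave like the edge cuts of a tree: an edge crosses at most one cut,
  and some edge at \<open>u\<close> crosses a cut that has to be crossed anyway in order to reach \<open>v\<close>. They force
  the distance in \<open>H\<close> to be the number of separating cuts.
\<close>

locale cut_distance =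
  fixes H :: "'b ugraph" and C :: "'c set" and S :: "'c \<Rightarrow> 'b set"
  assumes simple: "simple_graph H"
    and finite_cuts: "finite C"
    and edge_separators: "{u, v} \<in> edges H \<Longrightarrow> card (separators C S u v) \<le> 1"
    and closer_neighbour: "u \<in> verts H \<Longrightarrow> v \<in> verts H \<Longrightarrow> u \<noteq> v \<Longrightarrow>
      \<exists>u'. {u, u'} \<in> edges H \<and> separators C S u u' \<inter> separators C S u v \<noteq> {}"
begin

lemma finite_separators [simp]: "finite (separators C S u v)"
  using finite_cuts by (simp add: separators_def)

lemma card_separators_le_path_length:
  assumes "path_between H u v xs"
  shows "card (separators C S u v) \<le> path_length xs"
proof -
  have "card (separators C S (hd xs) (last xs)) \<le> length xs - 1"
    if "xs \<noteq> []" "successively (\<lambda>x y. {x, y} \<in> edges H) xs" for xs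
    using that
  proof (induction xs rule: induct_list012)
    case (3 x y zs)
    have "card (separators C S x (last (y # zs)))
        \<le> card (separators C S x y \<union> separators C S y (last (y # zs)))"
      by (intro card_mono separators_triangle) simp
    also have "\<dots> \<le> card (separators C S x y) + card (separators C S y (last (y # zs)))"
      by (rule card_Un_le)
    also have "\<dots> \<le> 1 + (length (y # zs) - 1)"
      using 3 by (intro add_mono edge_separators) auto
    finally show ?case by simp
  qed (auto simp: separators_def)
  then show ?thesis
    using assms by (auto simp: path_between_def path_length_def)
qed

text \<open>
  Walking greedily to a neighbour that is separated from the target by fewer cuts never visits a
  vertex twice, because the number of separating cuts decreases along the walk. The last conjunct
  carries this through the induction.
\<close>

lemma ex_path_of_length_separators:
  assumes "u \<in> verts H" "v \<in> verts H"
  shows "\<exists>xs. path_between H u v xs \<and> path_length xs \<le> card (separators C S u v) \<and>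
     (\<forall>x\<in>set xs. card (separators C S x v) \<le> card (separators C S u v))"
  using assms(1)
proof (induction "card (separators C S u v)" arbitrary: u rule: less_induct)
  case less
  show ?case
  proof (cases "u = v")
    case True
    then show ?thesis
      using less.prems by (intro exI[of _ "[v]"]) (auto simp: path_between_def path_length_def)
  next
    case False
    with closer_neighbour less.prems assms(2) obtain u' c where
      edge: "{u, u'} \<in> edges H" and c: "c \<in> separators C S u u'" "c \<in> separators C S u v"
      by blast
    have "separators C S u u' = {c}"
      using edge_separators[OF edge] c(1)
      by (metis One_nat_def card_le_Suc0_iff_eq finite_separators is_singletonI' empty_iff
          is_singletonE singletonD)
    then have only_c: "(u \<in> S d) = (u' \<in> S d) \<longleftrightarrow> d \<noteq> c" if "d \<in> C" for d
      using that unfolding separators_def by blast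
    have "separators C S u' v \<subseteq> separators C S u v - {c}"
    proof
      fix d assume d: "d \<in> separators C S u' v"
      then show "d \<in> separators C S u v - {c}"
        using c only_c[of d] by (cases "d = c") (simp_all add: separators_def)
    qed
    then have smaller: "card (separators C S u' v) < card (separators C S u v)"
      using c(2) by (metis Diff_iff finite_separators insertI1 psubset_card_mono psubsetI subset_iff)
    have "u' \<in> verts H"
      using edge simple by (auto simp: simple_graph_def)
    with less.hyps[OF smaller] obtain xs where
      xs: "path_between H u' v xs" "path_length xs \<le> card (separators C S u' v)"
        "\<forall>x\<in>set xs. card (separators C S x v) \<le> card (separators C S u' v)"
      by blast
    have "u \<notin> set xs"
      using xs(3) smaller by fastforce
    then have "path_between H u v (u # xs)"
      using xs(1) edge less.prems by (cases xs) (auto simp: path_between_def)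
    moreover have "path_length (u # xs) \<le> card (separators C S u v)"
      using xs(1,2) smaller by (cases xs) (auto simp: path_between_def path_length_def)
    ultimately show ?thesis
      using xs(3) smaller by (intro exI[of _ "u # xs"]) fastforce
  qed
qed

lemma shortest_path_length:
  assumes "shortest_path_between H u v xs"
  shows "path_length xs = card (separators C S u v)"
proof -
  have path: "path_between H u v xs"
    using assms by (simp add: shortest_path_between_def)
  then have "u \<in> verts H" "v \<in> verts H"
    by (auto simp: path_between_def)
  then obtain ys where "path_between H u v ys" "path_length ys \<le> card (separators C S u v)"
    using ex_path_of_length_separators by blast
  with assms card_separators_le_path_length[OF path] show ?thesis
    unfolding shortest_path_between_def by (meson le_antisym le_trans)
qed

lemma separators_eq_boundaries:
  assumes "simple_graph G" "{x, y} \<in> edges G"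
  shows "separators C S (g x) (g y) = {c \<in> C. {x, y} \<in> boundary G {z \<in> verts G. g z \<in> S c}}"
proof -
  have "{x, y} \<subseteq> verts G"
    using assms unfolding simple_graph_def by blast
  then show ?thesis
    using assms(2) by (auto simp: separators_def boundary_def)
qed

text \<open>
  Counting pairs of a cut and an edge of \<open>G\<close> stretched across it in two ways.
\<close>

lemma sum_boundaries:
  assumes "simple_graph G"
  shows "(\<Sum>c\<in>C. card (boundary G {z \<in> verts G. g z \<in> S c}))
    = (\<Sum>e\<in>edges G. card {c \<in> C. e \<in> boundary G {z \<in> verts G. g z \<in> S c}})"
proof -
  have "edges G \<subseteq> Pow (verts G)" "finite (verts G)"
    using assms by (auto simp: simple_graph_def)
  then have "finite (edges G)"
    using finite_subset by blast
  then have "(\<Sum>e\<in>edges G. card {c \<in> C. e \<in> boundary G {z \<in> verts G. g z \<in> S c}})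
    = (\<Sum>c\<in>C. card {e \<in> edges G. e \<in> boundary G {z \<in> verts G. g z \<in> S c}})"
    using finite_cuts by (intro sum_multicount_gen) auto
  then show ?thesis
    by (simp add: boundary_def)
qed

lemma sum_boundaries_le_wirelength:
  assumes "simple_graph G" "is_embedding G H g Q"
  shows "(\<Sum>c\<in>C. card (boundary G {z \<in> verts G. g z \<in> S c})) \<le> embedding_wirelength G Q"
  unfolding sum_boundaries[OF assms(1)] embedding_wirelength_def
proof (rule sum_mono)
  fix e assume e: "e \<in> edges G"
  then have "\<exists>x y. e = {x, y} \<and> path_between H (g x) (g y) (Q e)"
    using assms(2) by (simp add: is_embedding_def)
  then obtain x y where xy: "e = {x, y}" "path_between H (g x) (g y) (Q e)"
    by blast
  show "card {c \<in> C. e \<in> boundary G {z \<in> verts G. g z \<in> S c}} \<le> path_length (Q e)"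
    using separators_eq_boundaries[OF assms(1), of x y g] card_separators_le_path_length[OF xy(2)]
      e xy(1) by simp
qed

lemma wirelength_shortest_routing:
  assumes "simple_graph G" "shortest_routing G H g Q"
  shows "embedding_wirelength G Q = (\<Sum>c\<in>C. card (boundary G {z \<in> verts G. g z \<in> S c}))"
  unfolding sum_boundaries[OF assms(1)] embedding_wirelength_def
proof (rule sum.cong)
  fix e assume e: "e \<in> edges G"
  then have "\<exists>x y. e = {x, y} \<and> shortest_path_between H (g x) (g y) (Q e)"
    using assms(2) by (simp add: shortest_routing_def)
  then obtain x y where xy: "e = {x, y}" "shortest_path_between H (g x) (g y) (Q e)"
    by blast
  show "path_length (Q e) = card {c \<in> C. e \<in> boundary G {z \<in> verts G. g z \<in> S c}}"
    using separators_eq_boundaries[OF assms(1), of x y g] shortest_path_length[OF xy(2)]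
      e xy(1) by simp
qed simp

end

section \<open>Edge boundaries in complete multipartite graphs\<close>

text \<open>
  Each vertex of \<open>A\<close> sends edges to all of \<open>V - A\<close> except the rest of its own part; the latter has
  \<open>q\<close> elements less those already in \<open>A\<close>. Stated additively to avoid truncated subtraction.
\<close>

lemma card_boundary_complete_multipartite:
  fixes part :: "'a \<Rightarrow> 'c"
  assumes fin: "finite V" "finite R" and sub: "A \<subseteq> V" and R: "part ` V \<subseteq> R"
    and q: "\<And>r. r \<in> R \<Longrightarrow> card {x \<in> V. part x = r} = q"
  shows "card (boundary (complete_multipartite V part) A) + q * card A
    = card A * card (V - A) + (\<Sum>r\<in>R. (card {x \<in> A. part x = r})\<^sup>2)"
proof -
  have finA: "finite A"
    using fin sub finite_subset by blast
  \<comment> \<open>Orienting each boundary edge from its end in \<open>A\<close> to its end outside makes it an ordered pair.\<close>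
  let ?D = "SIGMA x:A. {y \<in> V - A. part y \<noteq> part x}"
  let ?E = "complete_multipartite V part"
  have "boundary ?E A = (\<lambda>(x, y). {x, y}) ` ?D" (is "?L = ?R")
  proof
    show "?R \<subseteq> ?L"
      using sub by (auto simp: boundary_def complete_multipartite_def)
    show "?L \<subseteq> ?R"
    proof
      fix e assume "e \<in> ?L"
      then obtain x y where e: "e = {x, y}" "x \<in> V" "y \<in> V" "part x \<noteq> part y"
        and cross: "e \<inter> A \<noteq> {}" "\<not> e \<subseteq> A"
        by (auto simp: boundary_def complete_multipartite_def)
      from cross e consider "x \<in> A" "y \<notin> A" | "x \<notin> A" "y \<in> A"
        by auto
      then show "e \<in> ?R"
      proof cases
        case 1
        then show ?thesis
          using e by (intro image_eqI[of _ _ "(x, y)"]) auto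
      next
        case 2
        then show ?thesis
          using e by (intro image_eqI[of _ _ "(y, x)"]) auto
      qed
    qed
  qed
  moreover have "inj_on (\<lambda>(x, y). {x, y}) ?D"
    by (auto simp: inj_on_def doubleton_eq_iff)
  ultimately have "card (boundary ?E A) = card ?D"
    by (simp add: card_image)
  also have "\<dots> = (\<Sum>x\<in>A. card {y \<in> V - A. part y \<noteq> part x})"
    using fin finA by (intro card_SigmaI) auto
  finally have "card (boundary ?E A) + q * card A
    = (\<Sum>x\<in>A. card {y \<in> V - A. part y \<noteq> part x} + q)"
    by (simp add: sum.distrib)
  also have "\<dots> = (\<Sum>x\<in>A. card (V - A) + card {y \<in> A. part y = part x})"
  proof (rule sum.cong)
    fix x assume "x \<in> A"
    have "{y \<in> V. part y = part x}
        = {y \<in> A. part y = part x} \<union> {y \<in> V - A. part y = part x}"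
      using sub by auto
    then have "q = card {y \<in> A. part y = part x} + card {y \<in> V - A. part y = part x}"
      using q[of "part x"] R sub \<open>x \<in> A\<close> fin finA
      by (simp add: card_Un_disjoint[symmetric] disjoint_iff image_subset_iff subset_iff)
    moreover have "card (V - A)
        = card ({y \<in> V - A. part y = part x} \<union> {y \<in> V - A. part y \<noteq> part x})"
      by (rule arg_cong[of _ _ card]) auto
    then have "card (V - A)
        = card {y \<in> V - A. part y = part x} + card {y \<in> V - A. part y \<noteq> part x}"
      using fin by (subst (asm) card_Un_disjoint) auto
    ultimately show "card {y \<in> V - A. part y \<noteq> part x} + q
        = card (V - A) + card {y \<in> A. part y = part x}"
      by simp
  qed simp
  also have "\<dots> = card A * card (V - A) + (\<Sum>x\<in>A. card {y \<in> A. part y = part x})"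
    by (simp add: sum.distrib)
  also have "(\<Sum>x\<in>A. card {y \<in> A. part y = part x})
    = (\<Sum>r\<in>R. \<Sum>x\<in>{x \<in> A. part x = r}. card {y \<in> A. part y = part x})"
    using finA fin R sub by (intro sum.group[symmetric]) auto
  also have "\<dots> = (\<Sum>r\<in>R. (card {x \<in> A. part x = r})\<^sup>2)"
    by (intro sum.cong) (auto simp: power2_eq_square)
  finally show ?thesis .
qed

text \<open>
  No integer lies strictly between \<open>t\<close> and \<open>t + 1\<close>, so \<open>(b - t) (b - t - 1)\<close> is nonnegative for
  every integer \<open>b\<close>; this is the tangent-line form of the convexity of the square.
\<close>

lemma square_ge_chord:
  fixes b t :: int
  shows "(2 * t + 1) * b - t * (t + 1) \<le> b\<^sup>2"
proof -
  have "0 \<le> (b - t) * (b - t - 1)"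
    by (cases "b \<le> t") (auto intro: mult_nonneg_nonneg mult_nonpos_nonpos)
  then show ?thesis
    by (simp add: algebra_simps power2_eq_square)
qed

lemma sum_squares_ge:
  fixes a :: "'r \<Rightarrow> nat" and t :: int
  shows "(2 * t + 1) * int (\<Sum>r\<in>R. a r) - int (card R) * (t * (t + 1)) \<le> int (\<Sum>r\<in>R. (a r)\<^sup>2)"
proof -
  have "(\<Sum>r\<in>R. (2 * t + 1) * int (a r) - t * (t + 1)) \<le> (\<Sum>r\<in>R. (int (a r))\<^sup>2)"
    by (intro sum_mono square_ge_chord)
  then show ?thesis
    by (simp add: sum_subtractf sum_distrib_left)
qed

lemma sum_squares_balanced:
  fixes a :: "'r \<Rightarrow> nat" and t :: nat
  assumes "\<And>r. r \<in> R \<Longrightarrow> a r = t \<or> a r = t + 1"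
  shows "int (\<Sum>r\<in>R. (a r)\<^sup>2)
    = (2 * int t + 1) * int (\<Sum>r\<in>R. a r) - int (card R) * (int t * (int t + 1))"
proof -
  have "(\<Sum>r\<in>R. (int (a r))\<^sup>2) = (\<Sum>r\<in>R. (2 * int t + 1) * int (a r) - int t * (int t + 1))"
    using assms by (intro sum.cong) (fastforce simp: algebra_simps power2_eq_square)+
  then show ?thesis
    by (simp add: sum_subtractf sum_distrib_left)
qed

lemma card_residue_block:
  fixes R :: nat
  assumes "r < R"
  shows "card {x \<in> {a..<a + R}. x mod R = r} = 1"
proof -
  have inj: "inj_on (\<lambda>x. x mod R) {a..<a + R}"
  proof (rule inj_onI)
    fix x y assume "x \<in> {a..<a + R}" "y \<in> {a..<a + R}" "x mod R = y mod R"
    moreover have "u = v" if "u \<le> v" "v < u + R" "u mod R = v mod R" for u v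
    proof -
      have "R dvd v - u"
        using that by (metis mod_eq_dvd_iff_nat)
      then show ?thesis
        using that by (auto dest: dvd_imp_le)
    qed
    ultimately show "x = y"
      by (metis atLeastLessThan_iff add_le_mono1 less_le_trans nat_le_linear)
  qed
  have "(\<lambda>x. x mod R) ` {a..<a + R} = {..<R}"
    using inj assms by (intro card_subset_eq) (auto simp: card_image)
  then obtain x where x: "x \<in> {a..<a + R}" "x mod R = r"
    using assms by (metis imageE lessThan_iff)
  then have "{x \<in> {a..<a + R}. x mod R = r} = {x}"
    using inj by (auto simp: inj_on_def)
  then show ?thesis
    by simp
qed

lemma card_residue_blocks:
  fixes R :: nat
  assumes "r < R"
  shows "card {x \<in> {a..<a + t * R}. x mod R = r} = t"
proof (induction t)
  case (Suc t)
  have "{x \<in> {a..<a + Suc t * R}. x mod R = r}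
    = {x \<in> {a..<a + t * R}. x mod R = r} \<union> {x \<in> {a + t * R..<a + t * R + R}. x mod R = r}"
    by auto
  also have "card \<dots> = t + 1"
    using Suc card_residue_block[OF assms, of "a + t * R"]
    by (subst card_Un_disjoint) auto
  finally show ?case by simp
qed simp

text \<open>
  The interval lies between \<open>s div R\<close> and \<open>s div R + 1\<close> full blocks of \<open>R\<close> consecutive numbers.
\<close>

lemma card_residue_interval:
  fixes R :: nat
  assumes "r < R"
  shows "card {x \<in> {a..<a + s}. x mod R = r} = s div R
    \<or> card {x \<in> {a..<a + s}. x mod R = r} = s div R + 1"
proof -
  let ?N = "\<lambda>s. card {x \<in> {a..<a + s}. x mod R = r}"
  have "?N (s div R * R) \<le> ?N s"
    by (intro card_mono) (auto intro: less_le_trans)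
  moreover have "?N s \<le> ?N ((s div R + 1) * R)"
  proof (intro card_mono)
    have "s < (s div R + 1) * R"
      using assms by (metis Suc_eq_plus1 dividend_less_div_times add.commute
          mult.commute mult_Suc_right gr_zeroI not_less_zero)
    then show "{x \<in> {a..<a + s}. x mod R = r} \<subseteq> {x \<in> {a..<a + (s div R + 1) * R}. x mod R = r}"
      by auto
  qed simp
  ultimately have "s div R \<le> ?N s" "?N s \<le> s div R + 1"
    by (simp_all only: card_residue_blocks[OF assms])
  then show ?thesis
    by linarith
qed

text \<open>
  The boundary size of an \<open>s\<close>-element set whose intersections with the \<open>2\<^sup>p\<close> parts have size \<open>t\<close> or
  \<open>t + 1\<close>. The last line is then the sum of the squares of these sizes; writing it as the chord
  of the square between \<open>t\<close> and \<open>t + 1\<close> makes it linear in \<open>s\<close>, so that the number of parts of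
  either size need not be known.
\<close>

definition min_boundary :: "nat \<Rightarrow> nat \<Rightarrow> nat \<Rightarrow> int" where
  "min_boundary n p s =
     (let t = int (s div 2 ^ p)
      in int s * (2 ^ n - int s) - 2 ^ (n - p) * int s
         + ((2 * t + 1) * int s - 2 ^ p * (t * (t + 1))))"

lemma card_residue_boundary:
  assumes "p \<le> n" "A \<subseteq> {1..2 ^ n}"
  shows "int (card (boundary (residue_multipartite n p) A))
    = int (card A) * (2 ^ n - int (card A)) - 2 ^ (n - p) * int (card A)
      + int (\<Sum>r<2 ^ p. (card {x \<in> A. x mod 2 ^ p = r})\<^sup>2)"
proof -
  have class_size: "card {x \<in> {1..2 ^ n}. x mod 2 ^ p = r} = 2 ^ (n - p)" if "r < 2 ^ p" for r :: nat
  proof -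
    have "{1..(2::nat) ^ n} = {1..<1 + 2 ^ (n - p) * 2 ^ p}"
      using assms(1) by (auto simp flip: power_add)
    then show ?thesis
      using card_residue_blocks[OF that, of 1 "2 ^ (n - p)"] by simp
  qed
  have "card (boundary (residue_multipartite n p) A) + 2 ^ (n - p) * card A
    = card A * card ({1..2 ^ n} - A) + (\<Sum>r<2 ^ p. (card {x \<in> A. x mod 2 ^ p = r})\<^sup>2)"
    unfolding residue_multipartite_def
    using assms(2) class_size
    by (intro card_boundary_complete_multipartite) auto
  moreover have "int (card ({1..2 ^ n} - A)) = 2 ^ n - int (card A)"
    using assms(2) card_mono[OF _ assms(2)] finite_subset[OF assms(2)]
    by (simp add: card_Diff_subset of_nat_diff)
  ultimately have "int (card (boundary (residue_multipartite n p) A)) + 2 ^ (n - p) * int (card A)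
    = int (card A) * (2 ^ n - int (card A)) + int (\<Sum>r<2 ^ p. (card {x \<in> A. x mod 2 ^ p = r})\<^sup>2)"
    by (metis (no_types, lifting) of_nat_add of_nat_mult of_nat_numeral of_nat_power)
  then show ?thesis
    by linarith
qed

lemma sum_residue_counts:
  fixes R :: nat
  assumes "finite A" "R > 0"
  shows "(\<Sum>r<R. card {x \<in> A. x mod R = r}) = card A"
proof -
  have "(\<lambda>x. x mod R) ` A \<subseteq> {..<R}"
    using assms(2) by auto
  then show ?thesis
    using sum.group[of A "{..<R}" "\<lambda>x. x mod R" "\<lambda>_. 1::nat"] assms(1) by simp
qed

lemma min_boundary_le:
  assumes "p \<le> n" "A \<subseteq> {1..2 ^ n}"
  shows "min_boundary n p (card A) \<le> int (card (boundary (residue_multipartite n p) A))"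
proof -
  have "finite A"
    using assms(2) finite_subset by blast
  then have "(\<Sum>r<2 ^ p. card {x \<in> A. x mod 2 ^ p = r}) = card A"
    by (simp add: sum_residue_counts)
  then show ?thesis
    using sum_squares_ge[of "int (card A div 2 ^ p)" "\<lambda>r. card {x \<in> A. x mod 2 ^ p = r}" "{..<2 ^ p}"]
    unfolding card_residue_boundary[OF assms] min_boundary_def Let_def
    by (simp only: card_lessThan of_nat_power of_nat_numeral add_left_mono)
qed

lemma card_boundary_interval:
  assumes "p \<le> n" "{a..<a + s} \<subseteq> {1..2 ^ n}"
  shows "int (card (boundary (residue_multipartite n p) {a..<a + s})) = min_boundary n p s"
proof -
  let ?count = "\<lambda>r. card {x \<in> {a..<a + s}. x mod 2 ^ p = r}"
  have "(\<Sum>r<2 ^ p. ?count r) = s"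
    using sum_residue_counts[of "{a..<a + s}" "2 ^ p"] by simp
  moreover have "int (\<Sum>r<2 ^ p. (?count r)\<^sup>2) = (2 * int (s div 2 ^ p) + 1) * int (\<Sum>r<2 ^ p. ?count r)
      - int (card {..<(2::nat) ^ p}) * (int (s div 2 ^ p) * (int (s div 2 ^ p) + 1))"
    by (intro sum_squares_balanced card_residue_interval) simp
  ultimately show ?thesis
    unfolding card_residue_boundary[OF assms] min_boundary_def Let_def
    by (simp only: card_lessThan of_nat_power of_nat_numeral card_atLeastLessThan diff_add_inverse)
qed

section \<open>The tree and its labelling\<close>

lemma value_map_tree: "t \<noteq> \<langle>\<rangle> \<Longrightarrow> value (map_tree f t) = f (value t)"
  by (cases t) auto

lemma map_tree_eq_Leaf: "map_tree f t = \<langle>\<rangle> \<longleftrightarrow> t = \<langle>\<rangle>"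
  by (cases t) auto

lemma root_edges_eq_image:
  "{{a, value t} | t. t \<in> T \<and> t \<noteq> \<langle>\<rangle>} = (\<lambda>t. {a, value t}) ` (T - {\<langle>\<rangle>})"
  by auto

lemma tree_edges_map_tree: "tree_edges (map_tree f t) = image f ` tree_edges t"
proof (induction t)
  case (Node l a r)
  have "{map_tree f l, map_tree f r} - {\<langle>\<rangle>} = map_tree f ` ({l, r} - {\<langle>\<rangle>})"
    by (auto simp: map_tree_eq_Leaf)
  moreover have "(\<lambda>t. {f a, value t}) ` map_tree f ` ({l, r} - {\<langle>\<rangle>})
      = image f ` (\<lambda>t. {a, value t}) ` ({l, r} - {\<langle>\<rangle>})"
    unfolding image_image by (intro image_cong) (auto simp: value_map_tree)
  ultimately show ?case
    using Node by (simp only: tree.map tree_edges.simps root_edges_eq_image image_Un)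
qed simp

lemma binary_tree_eq_Leaf: "binary_tree m = \<langle>\<rangle> \<longleftrightarrow> m = 0"
  by (cases m) auto

lemma value_binary_tree: "m > 0 \<Longrightarrow> value (binary_tree m) = []"
  by (cases m) auto

lemma set_binary_tree: "set_tree (binary_tree m) = {w. length w < m}"
proof (induction m)
  case (Suc m)
  have "w \<in> {w. length w < Suc m} \<longleftrightarrow>
      w = [] \<or> w \<in> Cons False ` {w. length w < m} \<or> w \<in> Cons True ` {w. length w < m}" for w
    by (cases w) (auto simp: image_iff)
  with Suc show ?case
    by (auto simp: tree.set_map)
qed simp

text \<open>
  Below the two edges at the root, both halves are copies of the smaller tree, and prefixing a
  letter commutes with \<open>butlast\<close> on nonempty words.
\<close>

lemma edges_binary_tree:
  "tree_edges (binary_tree m) = (\<lambda>w. {w, butlast w}) ` {w. w \<noteq> [] \<and> length w < m}"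
proof (induction m)
  case (Suc m)
  let ?X = "{w. w \<noteq> [] \<and> length w < m}" and ?top = "if m = 0 then {} else {[False], [True]}"
  have top: "(\<lambda>t. {[], value t}) `
      ({map_tree (Cons False) (binary_tree m), map_tree (Cons True) (binary_tree m)} - {\<langle>\<rangle>})
    = (\<lambda>w. {w, butlast w}) ` ?top"
    by (cases "m = 0")
       (auto simp: binary_tree_eq_Leaf map_tree_eq_Leaf value_map_tree value_binary_tree insert_Diff_if)
  have below: "image (Cons b) ` (\<lambda>w. {w, butlast w}) ` ?X = (\<lambda>w. {w, butlast w}) ` Cons b ` ?X"
    for b :: bool
    unfolding image_image by (intro image_cong) auto
  have "w \<in> {w. w \<noteq> [] \<and> length w < Suc m} \<longleftrightarrow> w \<in> ?top \<union> Cons False ` ?X \<union> Cons True ` ?X" for w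
  proof (cases w)
    case (Cons b w')
    then show ?thesis
      by (cases b; cases "w' = []") (auto simp: image_iff)
  qed auto
  then have "{w. w \<noteq> [] \<and> length w < Suc m} = ?top \<union> Cons False ` ?X \<union> Cons True ` ?X"
    by blast
  then show ?case
    by (simp only: binary_tree.simps tree_edges.simps root_edges_eq_image top tree_edges_map_tree
        Suc below image_Un)
qed simp

text \<open>
  The orientation of \<open>T\<^sub>m\<^sup>k\<close> towards \<open>(k, None)\<close>. Rooting at the end of the chain makes the
  descendants of each \<open>(i, None)\<close> an initial segment of the labelling.
\<close>

fun parent :: "nat \<times> bool list option \<Rightarrow> nat \<times> bool list option" where
  "parent (i, None) = (i + 1, None)"
| "parent (i, Some w) = (i, if w = [] then None else Some (butlast w))"

fun descendants :: "nat \<Rightarrow> nat \<Rightarrow> nat \<times> bool list option \<Rightarrow> (nat \<times> bool list option) set" where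
  "descendants m k (i, None) = {1..i} \<times> verts (one_rooted_tree m)"
| "descendants m k (i, Some w) = {(i, Some (w @ x)) | x. length (w @ x) < m}"

lemma verts_one_rooted_tree: "verts (one_rooted_tree m) = insert None (Some ` {w. length w < m})"
  by (simp add: one_rooted_tree_def set_binary_tree)

lemma verts_k_rooted_tree: "verts (k_rooted_tree m k) = {1..k} \<times> verts (one_rooted_tree m)"
  by (simp add: k_rooted_tree_def)

lemma edges_k_rooted_tree:
  assumes "m \<ge> 1"
  shows "edges (k_rooted_tree m k)
    = {{u, parent u} | u. u \<in> verts (k_rooted_tree m k) \<and> u \<noteq> (k, None)}" (is "?L = ?R")
proof
  have one: "edges (one_rooted_tree m) = insert {None, Some []}
      ((\<lambda>w. {Some w, Some (butlast w)}) ` {w. w \<noteq> [] \<and> length w < m})"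
    using assms by (simp add: one_rooted_tree_def value_binary_tree edges_binary_tree image_image)
  show "?L \<subseteq> ?R"
  proof
    fix e assume "e \<in> ?L"
    then consider (copy) i e' where "i \<in> {1..k}" "e' \<in> edges (one_rooted_tree m)" "e = Pair i ` e'"
      | (join) i where "e = {(i, None), (i + 1, None)}" "1 \<le> i" "i < k"
      by (force simp: k_rooted_tree_def)
    then show "e \<in> ?R"
    proof cases
      case copy
      from copy(2) consider "e' = {None, Some []}"
        | w where "e' = {Some w, Some (butlast w)}" "w \<noteq> []" "length w < m"
        unfolding one by blast
      then show ?thesis
      proof cases
        case 1
        then show ?thesis
          using assms copy by (intro CollectI exI[of _ "(i, Some [])"])
            (auto simp: verts_k_rooted_tree verts_one_rooted_tree)
      next
        case 2
        then show ?thesis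
          using copy by (intro CollectI exI[of _ "(i, Some w)"])
            (auto simp: verts_k_rooted_tree verts_one_rooted_tree)
      qed
    next
      case join
      then show ?thesis
        by (intro CollectI exI[of _ "(i, None)"]) (auto simp: verts_k_rooted_tree verts_one_rooted_tree)
    qed
  qed
  show "?R \<subseteq> ?L"
  proof
    fix e assume "e \<in> ?R"
    then obtain i x where e: "e = {(i, x), parent (i, x)}" "(i, x) \<noteq> (k, None)" "i \<in> {1..k}"
      and x: "x \<in> verts (one_rooted_tree m)"
      by (auto simp: verts_k_rooted_tree)
    show "e \<in> ?L"
    proof (cases x)
      case None
      with e show ?thesis
        by (auto simp: k_rooted_tree_def)
    next
      case (Some w)
      with x have w: "length w < m"
        by (auto simp: verts_one_rooted_tree)
      let ?e = "if w = [] then {None, Some []} else {Some w, Some (butlast w)}"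
      have "?e \<in> edges (one_rooted_tree m)"
        unfolding one using w by auto
      moreover have "e = Pair i ` ?e"
        using e(1) Some by (auto simp: insert_commute)
      ultimately have "e \<in> (\<Union>i\<in>{1..k}. image (Pair i) ` edges (one_rooted_tree m))"
        using e(3) by blast
      then show ?thesis
        by (simp add: k_rooted_tree_def)
    qed
  qed
qed

lemma mem_descendants_Some:
  "(i, Some w) \<in> descendants m k (j, Some v) \<longleftrightarrow> i = j \<and> length w < m \<and> (\<exists>x. w = v @ x)"
  "(i, None) \<notin> descendants m k (j, Some v)"
  by auto

lemma mem_descendants_self: "u \<in> verts (k_rooted_tree m k) \<Longrightarrow> u \<in> descendants m k u"
  by (cases u; cases "snd u") (auto simp: verts_k_rooted_tree verts_one_rooted_tree)

text \<open>
  The edge from \<open>u\<close> to its parent crosses the cut of \<open>u\<close> and no other one.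
\<close>

lemma mem_descendants_parent:
  assumes "m \<ge> 1" "u \<in> verts (k_rooted_tree m k)" "u \<noteq> (k, None)" "c \<in> verts (k_rooted_tree m k)"
  shows "parent u \<in> descendants m k c \<longleftrightarrow> u \<in> descendants m k c \<and> u \<noteq> c"
proof -
  obtain i x j y where [simp]: "u = (i, x)" "c = (j, y)"
    by fastforce
  show ?thesis
  proof (cases x)
    case None
    then show ?thesis
      using assms by (cases y) (auto simp: verts_k_rooted_tree verts_one_rooted_tree)
  next
    case [simp]: (Some w)
    show ?thesis
    proof (cases y)
      case None
      then show ?thesis
        using assms by (auto simp: verts_k_rooted_tree verts_one_rooted_tree)
    next
      case [simp]: (Some v)
      have "(\<exists>x. butlast w = v @ x) \<longleftrightarrow> (\<exists>x. w = v @ x) \<and> w \<noteq> v" if "w \<noteq> []"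
      proof
        assume "\<exists>x. butlast w = v @ x"
        then obtain x where "butlast w = v @ x"
          by blast
        then have "w = v @ (x @ [last w])"
          using append_butlast_last_id[OF that] by simp
        then obtain y where "w = v @ y" "y \<noteq> []"
          by blast
        then show "(\<exists>x. w = v @ x) \<and> w \<noteq> v"
          by simp
      qed (auto simp: butlast_append)
      moreover have "length w < m" "length (butlast w) < m"
        using assms(2) by (auto simp: verts_k_rooted_tree verts_one_rooted_tree)
      ultimately show ?thesis
        by (auto simp: mem_descendants_Some simp del: descendants.simps(2))
    qed
  qed
qed

lemma ex_child_above:
  assumes "u \<in> verts (k_rooted_tree m k)" "v \<in> descendants m k u" "v \<noteq> u"
  shows "\<exists>c\<in>verts (k_rooted_tree m k). c \<noteq> (k, None) \<and> parent c = u \<and> v \<in> descendants m k c"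
proof -
  obtain i x where u: "u = (i, x)"
    by fastforce
  show ?thesis
  proof (cases x)
    case None
    obtain j y where v: "v = (j, y)" "j \<in> {1..i}" "y \<in> verts (one_rooted_tree m)"
      using assms(2) u None by auto
    show ?thesis
    proof (cases "j = i")
      case True
      then obtain w where "y = Some w" "length w < m"
        using v assms(3) u None by (auto simp: verts_one_rooted_tree)
      then show ?thesis
        using u None v True assms(1)
        by (intro bexI[of _ "(i, Some [])"]) (auto simp: verts_k_rooted_tree verts_one_rooted_tree)
    next
      case False
      then show ?thesis
        using u None v assms(1)
        by (intro bexI[of _ "(i - 1, None)"]) (auto simp: verts_k_rooted_tree verts_one_rooted_tree)
    qed
  next
    case (Some w)
    then obtain y where y: "v = (i, Some (w @ y))" "length (w @ y) < m" "y \<noteq> []"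
      using assms(2,3) u by auto
    then obtain b z where "v = (i, Some (w @ b # z))" "length (w @ b # z) < m"
      by (cases y) auto
    then show ?thesis
      using u Some assms(1)
      by (intro bexI[of _ "(i, Some (w @ [b]))"]) (auto simp: verts_k_rooted_tree verts_one_rooted_tree)
  qed
qed

lemma separators_parent:
  assumes "m \<ge> 1" "u \<in> verts (k_rooted_tree m k)" "u \<noteq> (k, None)"
  shows "separators (verts (k_rooted_tree m k)) (descendants m k) u (parent u) = {u}"
  using mem_descendants_parent[OF assms] mem_descendants_self[OF assms(2)] assms(2)
  by (auto simp: separators_def)

text \<open>
  To approach \<open>v\<close> from \<open>u\<close>, descend to the child above \<open>v\<close> if \<open>v\<close> is a descendant of \<open>u\<close>, and climb
  to the parent otherwise.
\<close>

lemma cut_distance_k_rooted_tree: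
  assumes "m \<ge> 1"
  shows "cut_distance (k_rooted_tree m k) (verts (k_rooted_tree m k)) (descendants m k)"
proof
  let ?V = "verts (k_rooted_tree m k)"
  show simple: "simple_graph (k_rooted_tree m k)"
    using assms by (rule simple_graph_k_rooted_tree)
  then show "finite ?V"
    by (simp add: simple_graph_def)
  show "card (separators ?V (descendants m k) u v) \<le> 1"
    if "{u, v} \<in> edges (k_rooted_tree m k)" for u v
  proof -
    from that obtain w where "w \<in> ?V" "w \<noteq> (k, None)" "{u, v} = {w, parent w}"
      unfolding edges_k_rooted_tree[OF assms] by blast
    then have "separators ?V (descendants m k) u v = {w}"
      using separators_parent[OF assms, of w k] separators_commute[of ?V "descendants m k" u v]
      by (auto simp only: doubleton_eq_iff)
    then show ?thesis
      by simp
  qed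
  show "\<exists>u'. {u, u'} \<in> edges (k_rooted_tree m k) \<and>
      separators ?V (descendants m k) u u' \<inter> separators ?V (descendants m k) u v \<noteq> {}"
    if uv: "u \<in> ?V" "v \<in> ?V" "u \<noteq> v" for u v
  proof (cases "v \<in> descendants m k u")
    case True
    with ex_child_above uv obtain c where c: "c \<in> ?V" "c \<noteq> (k, None)" "parent c = u" "v \<in> descendants m k c"
      by metis
    have "{u, c} = {c, parent c}"
      using c(3) by auto
    then have "{u, c} \<in> edges (k_rooted_tree m k)"
      unfolding edges_k_rooted_tree[OF assms] using c(1,2) by blast
    moreover have "separators ?V (descendants m k) u c = {c}"
      using separators_parent[OF assms c(1,2)] c(3) separators_commute by metis
    then have "c \<in> separators ?V (descendants m k) u c \<inter> separators ?V (descendants m k) u v"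
      using c(4) mem_descendants_self[OF c(1)] by (auto simp: separators_def)
    ultimately show ?thesis by blast
  next
    case False
    have "u \<noteq> (k, None)"
      using False uv by (auto simp: verts_k_rooted_tree)
    moreover have "{u, parent u} \<in> edges (k_rooted_tree m k)"
      unfolding edges_k_rooted_tree[OF assms] using uv(1) \<open>u \<noteq> (k, None)\<close> by blast
    moreover have "u \<in> separators ?V (descendants m k) u v"
      using False uv(1) mem_descendants_self[OF uv(1)] by (auto simp: separators_def)
    ultimately show ?thesis
      using separators_parent[OF assms uv(1)] by blast
  qed
qed

text \<open>
  Inorder traversal lists the whole left subtree before the root and the whole right subtree after
  it, so by recursion it lists every subtree without interruption.
\<close>

lemma inorder_binary_tree_block:
  assumes "length w < m"
  shows "\<exists>xs ys zs. inorder (binary_tree m) = xs @ ys @ zs \<and>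
    set ys = {w @ x | x. length (w @ x) < m}"
  using assms
proof (induction m arbitrary: w)
  case (Suc m)
  show ?case
  proof (cases w)
    case Nil
    then show ?thesis
      using set_binary_tree[of "Suc m"]
      by (intro exI[of _ "[]"] exI[of _ "inorder (binary_tree (Suc m))"]) (simp del: binary_tree.simps)
  next
    case (Cons b w')
    then have len: "length w' < m"
      using Suc.prems by simp
    obtain xs ys zs where split: "inorder (binary_tree m) = xs @ ys @ zs"
      "set ys = {w' @ x | x. length (w' @ x) < m}"
      using Suc.IH[OF len] by (elim exE conjE) (rule that)
    have set: "set (map (Cons b) ys) = {w @ x | x. length (w @ x) < Suc m}"
      using split(2) Cons by auto
    have "\<exists>xs' zs'. inorder (binary_tree (Suc m)) = xs' @ map (Cons b) ys @ zs'"
    proof (cases b)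
      case True
      then show ?thesis
        using split(1)
        by (intro exI[of _ "map (Cons False) (inorder (binary_tree m)) @ [] # map (Cons True) xs"]
            exI[of _ "map (Cons True) zs"]) (simp add: inorder_map)
    next
      case False
      then show ?thesis
        using split(1)
        by (intro exI[of _ "map (Cons False) xs"]
            exI[of _ "map (Cons False) zs @ [] # map (Cons True) (inorder (binary_tree m))"])
           (simp add: inorder_map)
    qed
    with set show ?thesis by blast
  qed
qed simp

lemma set_one_rooted_inorder: "set (one_rooted_inorder m) = verts (one_rooted_tree m)"
  by (auto simp: one_rooted_inorder_def verts_one_rooted_tree set_binary_tree)

lemma distinct_one_rooted_inorder: "distinct (one_rooted_inorder m)"
  by (auto simp: one_rooted_inorder_def distinct_map distinct_inorder_binary_tree)

lemma bij_vertex_labeled: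
  "bij_betw (vertex_labeled m) {1..k * 2 ^ m} (verts (k_rooted_tree m k))"
proof -
  let ?L = "one_rooted_inorder m"
  have nth: "bij_betw ((!) ?L) {..<2 ^ m} (verts (one_rooted_tree m))"
    by (rule bij_betw_nth)
       (auto simp: distinct_one_rooted_inorder set_one_rooted_inorder length_one_rooted_inorder)
  have "inj_on (vertex_labeled m) {1..k * 2 ^ m}"
  proof (rule inj_onI)
    fix x y assume xy: "x \<in> {1..k * 2 ^ m}" "y \<in> {1..k * 2 ^ m}"
      and eq: "vertex_labeled m x = vertex_labeled m y"
    have "(x - 1) mod 2 ^ m = (y - 1) mod 2 ^ m" "(x - 1) div 2 ^ m = (y - 1) div 2 ^ m"
      using eq nth_eq_iff_index_eq[OF distinct_one_rooted_inorder, of _ m]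
      by (auto simp: vertex_labeled_def length_one_rooted_inorder)
    then have "x - 1 = y - 1"
      by (metis div_mult_mod_eq)
    then show "x = y"
      using xy by auto
  qed
  moreover have "vertex_labeled m ` {1..k * 2 ^ m} = verts (k_rooted_tree m k)"
  proof
    show "vertex_labeled m ` {1..k * 2 ^ m} \<subseteq> verts (k_rooted_tree m k)"
    proof
      fix v assume "v \<in> vertex_labeled m ` {1..k * 2 ^ m}"
      then obtain x where x: "1 \<le> x" "x \<le> k * 2 ^ m" "v = vertex_labeled m x"
        by auto
      then have "(x - 1) div 2 ^ m < k"
        by (intro less_mult_imp_div_less) auto
      moreover have "?L ! ((x - 1) mod 2 ^ m) \<in> set ?L"
        by (intro nth_mem) (simp add: length_one_rooted_inorder)
      ultimately show "v \<in> verts (k_rooted_tree m k)"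
        using x(3) by (simp add: vertex_labeled_def verts_k_rooted_tree set_one_rooted_inorder)
    qed
    show "verts (k_rooted_tree m k) \<subseteq> vertex_labeled m ` {1..k * 2 ^ m}"
    proof
      fix v assume "v \<in> verts (k_rooted_tree m k)"
      then obtain i a where v: "v = (i, a)" "1 \<le> i" "i \<le> k" "a \<in> set ?L"
        by (auto simp: verts_k_rooted_tree set_one_rooted_inorder)
      then obtain j where j: "j < 2 ^ m" "a = ?L ! j"
        by (metis in_set_conv_nth length_one_rooted_inorder)
      have "(i - 1) * 2 ^ m + (j + 1) \<le> (i - 1) * 2 ^ m + 2 ^ m"
        using j by simp
      also have "\<dots> = i * 2 ^ m"
        using v(2) by (cases i) auto
      also have "\<dots> \<le> k * 2 ^ m"
        using v(3) by simp
      finally show "v \<in> vertex_labeled m ` {1..k * 2 ^ m}"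
        using vertex_labeled_copy[of i "j + 1" m] v j
        by (intro image_eqI[of _ _ "(i - 1) * 2 ^ m + (j + 1)"]) auto
    qed
  qed
  ultimately show ?thesis
    by (simp add: bij_betw_def)
qed

lemma vertex_labeled_block:
  assumes "1 \<le> i" "one_rooted_inorder m = xs @ ys @ zs"
  shows "vertex_labeled m ` {(i - 1) * 2 ^ m + length xs + 1..<(i - 1) * 2 ^ m + length xs + 1 + length ys}
    = Pair i ` set ys"
proof -
  have len: "length xs + length ys \<le> 2 ^ m"
    using length_one_rooted_inorder[of m] assms(2) by simp
  let ?a = "(i - 1) * 2 ^ m + length xs + 1"
  have "{?a..<?a + length ys} = (\<lambda>j. ?a + j) ` {0..<length ys}"
    unfolding image_add_atLeastLessThan by (simp add: add.commute)
  also have "\<dots> = (\<lambda>j. (i - 1) * 2 ^ m + (length xs + j + 1)) ` {0..<length ys}"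
    by (intro image_cong) simp_all
  also have "vertex_labeled m ` \<dots> = (\<lambda>j. (i, ys ! j)) ` {0..<length ys}"
    unfolding image_image
  proof (rule image_cong)
    fix j assume "j \<in> {0..<length ys}"
    then show "vertex_labeled m ((i - 1) * 2 ^ m + (length xs + j + 1)) = (i, ys ! j)"
      using vertex_labeled_copy[OF assms(1), of "length xs + j + 1" m] len assms(2)
      by (simp add: nth_append)
  qed simp
  also have "\<dots> = Pair i ` ((!) ys ` {0..<length ys})"
    by (simp add: image_image)
  also have "(!) ys ` {0..<length ys} = set ys"
    by (metis list.set_map map_nth set_upt)
  finally show ?thesis .
qed

lemma descendants_interval:
  assumes "c \<in> verts (k_rooted_tree m k)"
  shows "\<exists>a s. {x \<in> {1..k * 2 ^ m}. vertex_labeled m x \<in> descendants m k c} = {a..<a + s}"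
proof -
  let ?f = "vertex_labeled m"
  have inj: "inj_on ?f {1..k * 2 ^ m}" and ran: "?f ` {1..k * 2 ^ m} = verts (k_rooted_tree m k)"
    using bij_vertex_labeled[of m k] by (auto simp: bij_betw_def)
  have "\<exists>a s. {a..<a + s} \<subseteq> {1..k * 2 ^ m} \<and> ?f ` {a..<a + s} = descendants m k c"
  proof -
    obtain i y where c: "c = (i, y)" "1 \<le> i" "i \<le> k" "y \<in> verts (one_rooted_tree m)"
      using assms by (auto simp: verts_k_rooted_tree)
    show ?thesis
    proof (cases y)
      case None
      have bound: "i * 2 ^ m \<le> k * 2 ^ m"
        using c by simp
      have "?f ` {1..<1 + i * 2 ^ m} = descendants m k c"
        using bij_vertex_labeled[of m i] c None
        by (simp add: bij_betw_def verts_k_rooted_tree atLeastLessThanSuc_atLeastAtMost)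
      moreover have "{1..<1 + i * 2 ^ m} \<subseteq> {1..k * 2 ^ m}"
        using order.trans[OF _ bound] by (auto simp del: mult_le_cancel2)
      ultimately show ?thesis
        by blast
    next
      case (Some w)
      then have len: "length w < m"
        using c by (auto simp: verts_one_rooted_tree)
      obtain xs ys zs where split: "inorder (binary_tree m) = xs @ ys @ zs"
        "set ys = {w @ x | x. length (w @ x) < m}"
        using inorder_binary_tree_block[OF len] by (elim exE conjE) (rule that)
      then have L: "one_rooted_inorder m = map Some xs @ map Some ys @ (map Some zs @ [None])"
        by (simp add: one_rooted_inorder_def)
      have "length xs + length ys \<le> 2 ^ m"
        using length_one_rooted_inorder[of m] L by simp
      moreover have "(i - 1) * 2 ^ m + 2 ^ m \<le> k * 2 ^ m"
        using c by (cases i) (auto simp: add.commute simp flip: mult_Suc)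
      ultimately have "{(i - 1) * 2 ^ m + length xs + 1..<(i - 1) * 2 ^ m + length xs + 1 + length ys}
          \<subseteq> {1..k * 2 ^ m}"
        by auto
      moreover have "Pair i ` set (map Some ys) = descendants m k c"
        using split(2) c Some by auto
      ultimately show ?thesis
        using vertex_labeled_block[OF c(2) L]
        by (intro exI[of _ "(i - 1) * 2 ^ m + length xs + 1"] exI[of _ "length ys"]) simp
    qed
  qed
  then obtain a s where as: "{a..<a + s} \<subseteq> {1..k * 2 ^ m}" "?f ` {a..<a + s} = descendants m k c"
    by blast
  have "{x \<in> {1..k * 2 ^ m}. ?f x \<in> descendants m k c} = {a..<a + s}"
    unfolding as(2)[symmetric] using as(1) inj_on_image_mem_iff[OF inj _ as(1)] by blast
  then show ?thesis by blast
qed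

section \<open>Evaluating the sum of minimum boundaries\<close>

lemma card_verts_one_rooted_tree: "card (verts (one_rooted_tree m)) = 2 ^ m"
  using distinct_card[OF distinct_one_rooted_inorder, of m]
  by (simp add: set_one_rooted_inorder length_one_rooted_inorder)

lemma finite_bool_lists: "finite {w :: bool list. length w < m}"
  using finite_set_tree[of "binary_tree m"] by (simp add: set_binary_tree)

lemma card_bool_lists: "card {w :: bool list. length w < m} = 2 ^ m - 1"
  using card_verts_one_rooted_tree[of m] finite_bool_lists[of m]
  by (simp add: verts_one_rooted_tree card_insert_if card_image image_iff)

lemma descendants_subset_verts:
  assumes "c \<in> verts (k_rooted_tree m k)"
  shows "descendants m k c \<subseteq> verts (k_rooted_tree m k)"
proof -
  obtain i y where "c = (i, y)"
    by fastforce
  with assms show ?thesis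
    by (cases y) (auto simp: verts_k_rooted_tree verts_one_rooted_tree)
qed

lemma card_descendants_None: "card (descendants m k (i, None)) = i * 2 ^ m"
  by (simp add: card_cartesian_product card_verts_one_rooted_tree)

lemma card_descendants_Some: "card (descendants m k (i, Some w)) = 2 ^ (m - length w) - 1"
proof -
  have "descendants m k (i, Some w) = (\<lambda>x. (i, Some (w @ x))) ` {x. length x < m - length w}"
    by auto
  then show ?thesis
    by (simp add: card_image inj_on_def card_bool_lists)
qed

lemma sum_bool_lists_by_length:
  fixes g :: "nat \<Rightarrow> real"
  shows "(\<Sum>w | length (w :: bool list) < m. g (m - length w)) = (\<Sum>j = 1..m. 2 ^ (m - j) * g j)"
proof -
  let ?W = "{w :: bool list. length w < m}"
  have "(\<Sum>w\<in>?W. g (m - length w)) = (\<Sum>l<m. \<Sum>w | w \<in> ?W \<and> length w = l. g (m - length w))"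
    by (rule sum.group[symmetric]) (auto simp: finite_bool_lists)
  also have "\<dots> = (\<Sum>l<m. 2 ^ l * g (m - l))"
  proof (rule sum.cong)
    fix l assume "l \<in> {..<m}"
    then have "{w. w \<in> ?W \<and> length w = l} = {w. set w \<subseteq> UNIV \<and> length w = l}"
      by auto
    then have "card {w. w \<in> ?W \<and> length w = l} = 2 ^ l"
      using card_lists_length_eq[of "UNIV :: bool set" l] by simp
    then show "(\<Sum>w | w \<in> ?W \<and> length w = l. g (m - length w)) = 2 ^ l * g (m - l)"
      by simp
  qed simp
  also have "\<dots> = (\<Sum>j = 1..m. 2 ^ (m - j) * g j)"
    by (rule sum.reindex_bij_witness[of _ "\<lambda>j. m - j" "\<lambda>l. m - l"]) auto
  finally show ?thesis .
qed

text \<open>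
  Sorting the vertices by the size of their subtree: in each copy, \<open>2\<^bsup>m - j\<^esup>\<close> vertices carry a
  complete binary tree with \<open>j\<close> levels.
\<close>

lemma sum_verts_k_rooted_tree:
  fixes h :: "nat \<Rightarrow> real"
  shows "(\<Sum>c\<in>verts (k_rooted_tree m k). h (card (descendants m k c)))
    = real k * (\<Sum>j = 1..m. 2 ^ (m - j) * h (2 ^ j - 1)) + (\<Sum>i = 1..k. h (i * 2 ^ m))"
proof -
  have copy: "(\<Sum>y\<in>verts (one_rooted_tree m). h (card (descendants m k (i, y))))
      = h (i * 2 ^ m) + (\<Sum>j = 1..m. 2 ^ (m - j) * h (2 ^ j - 1))" for i
    unfolding verts_one_rooted_tree sum_bool_lists_by_length[symmetric]
    by (subst sum.insert)
       (auto simp: finite_bool_lists sum.reindex card_descendants_None card_descendants_Some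
          simp del: descendants.simps)
  have "(\<Sum>c\<in>verts (k_rooted_tree m k). h (card (descendants m k c)))
      = (\<Sum>i = 1..k. \<Sum>y\<in>verts (one_rooted_tree m). h (card (descendants m k (i, y))))"
    unfolding verts_k_rooted_tree sum.cartesian_product by (simp add: case_prod_beta)
  then show ?thesis
    by (simp add: copy sum.distrib)
qed

lemma real_min_boundary:
  assumes "p \<le> n" "s div 2 ^ p = t"
  shows "real_of_int (min_boundary n p s)
    = real s * (2 ^ (n - p) * 2 ^ p - real s) - 2 ^ (n - p) * real s
      + ((2 * real t + 1) * real s - 2 ^ p * (real t * (real t + 1)))"
proof -
  have "(2 :: real) ^ n = 2 ^ (n - p) * 2 ^ p"
    using assms(1) by (simp flip: power_add)
  then show ?thesis
    using assms(2) by (simp add: min_boundary_def Let_def)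
qed

text \<open>
  No edge leaves the whole vertex set; this is the contribution of the root of \<open>H\<close>, which has no
  edge above it but is kept among the cuts for uniformity.
\<close>

lemma min_boundary_all:
  assumes "p \<le> n"
  shows "real_of_int (min_boundary n p (2 ^ n)) = 0"
proof -
  have "(2 :: nat) ^ n = 2 ^ (n - p) * 2 ^ p"
    using assms by (simp flip: power_add)
  then have "(2 :: nat) ^ n div 2 ^ p = 2 ^ (n - p)" "real (2 ^ n) = 2 ^ (n - p) * 2 ^ p"
    by simp_all
  then show ?thesis
    using real_min_boundary[OF assms, of "2 ^ n" "2 ^ (n - p)"]
    by (simp add: algebra_simps)
qed

text \<open>
  For \<open>j > p\<close> the set is one vertex short of \<open>2\<^bsup>j - p\<^esup>\<close> full blocks, so \<open>t = 2\<^bsup>j - p\<^esup> - 1\<close>; for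
  \<open>j \<le> p\<close> it meets every part at most once and \<open>t = 0\<close>.
\<close>

lemma min_boundary_subtree:
  assumes "p \<le> n" "1 \<le> j"
  shows "real_of_int (min_boundary n p (2 ^ j - 1)) = c_term n p j"
proof -
  have s: "real (2 ^ j - 1) = 2 ^ j - 1"
    by (simp add: of_nat_diff)
  show ?thesis
  proof (cases "j \<le> p")
    case True
    have "(2 :: nat) ^ j - 1 < 2 ^ p"
      using power_increasing[OF True, of "2 :: nat"] zero_less_power[of "2 :: nat" j] by linarith
    then have "((2 :: nat) ^ j - 1) div 2 ^ p = 0"
      by simp
    from real_min_boundary[OF assms(1) this] show ?thesis
      unfolding s c_term_def using True by (simp add: algebra_simps)
  next
    case False
    define M R :: nat where "M = 2 ^ (j - p)" and "R = 2 ^ p"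
    have MR: "2 ^ j = M * R" "M \<ge> 1" "R \<ge> 1"
      using False unfolding M_def R_def by (simp_all flip: power_add)
    have "(M * R - 1) div R = M - 1"
      using MR(2,3) by (intro div_nat_eqI) (simp_all add: algebra_simps)
    then have t: "((2 :: nat) ^ j - 1) div 2 ^ p = 2 ^ (j - p) - 1"
      unfolding MR(1) by (simp add: M_def R_def)
    have j: "(2 :: real) ^ j = 2 ^ (j - p) * 2 ^ p"
      using False by (simp flip: power_add)
    have t': "real (2 ^ (j - p) - 1) = 2 ^ (j - p) - 1"
      by (simp add: of_nat_diff)
    have "(b * r - 1) * (q * r - (b * r - 1)) - q * (b * r - 1)
        + ((2 * (b - 1) + 1) * (b * r - 1) - r * ((b - 1) * (b - 1 + 1)))
      = (r - 1) * (q * (b * r - 1) - b * (b * r - 2))" for b r q :: real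
      by (simp add: algebra_simps)
    from this[of "2 ^ (j - p)" "2 ^ p" "2 ^ (n - p)"] show ?thesis
      unfolding real_min_boundary[OF assms(1) t] s t' c_term_def if_not_P[OF False] j .
  qed
qed

text \<open>
  The second case of \<open>d_term\<close> assumes that all parts are met equally, that is, \<open>2\<^sup>p\<close> divides
  \<open>i 2\<^sup>m\<close>; this holds for \<open>p \<le> m\<close>, and for \<open>p = n\<close> that case does not arise.
\<close>

lemma min_boundary_copies:
  assumes "p \<le> n" "i * 2 ^ m < 2 ^ n" "p \<le> m \<or> p = n"
  shows "real_of_int (min_boundary n p (i * 2 ^ m)) = d_term n p m i"
proof (cases "i * 2 ^ m \<le> 2 ^ p")
  case True
  show ?thesis
  proof (cases "i * 2 ^ m = 2 ^ p")
    case eq: True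
    then have t: "i * 2 ^ m div 2 ^ p = 1"
      by simp
    have x: "real (i * 2 ^ m) = 2 ^ p"
      unfolding eq by simp
    then have x': "real i * 2 ^ m = 2 ^ p"
      by simp
    show ?thesis
      unfolding real_min_boundary[OF assms(1) t] d_term_def if_P[OF True] x x'
      by (simp add: algebra_simps)
  next
    case False
    then have "i * 2 ^ m div 2 ^ p = 0"
      using True by simp
    then show ?thesis
      using real_min_boundary[OF assms(1), of "i * 2 ^ m" 0] True
      by (simp add: d_term_def algebra_simps)
  qed
next
  case False
  then have "p \<le> m"
    using assms(2,3) by auto
  then have split: "i * 2 ^ m = i * 2 ^ (m - p) * 2 ^ p"
    by (simp flip: power_add)
  have t: "i * 2 ^ m div 2 ^ p = i * 2 ^ (m - p)"
    unfolding split by simp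
  have "int m - int p = int (m - p)"
    using \<open>p \<le> m\<close> by simp
  then have powi: "(2 :: real) powi (int m - int p) = 2 ^ (m - p)"
    by (simp only: power_int_of_nat)
  have m: "(2 :: real) ^ m = 2 ^ (m - p) * 2 ^ p" and n: "(2 :: real) ^ n = 2 ^ (n - p) * 2 ^ p"
    using \<open>p \<le> m\<close> assms(1) by (simp_all flip: power_add)
  have x: "real (i * 2 ^ m) = real i * (2 ^ (m - p) * 2 ^ p)"
    and t': "real (i * 2 ^ (m - p)) = real i * 2 ^ (m - p)"
    by (simp_all flip: m)
  have "a * (b * r) * (q * r - a * (b * r)) - q * (a * (b * r))
      + ((2 * (a * b) + 1) * (a * (b * r)) - r * (a * b * (a * b + 1)))
    = a * b * (r - 1) * (q * r - a * (b * r))" for a b r q :: real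
    by (simp add: algebra_simps)
  from this[of "real i" "2 ^ (m - p)" "2 ^ p" "2 ^ (n - p)"] show ?thesis
    unfolding real_min_boundary[OF assms(1) t] x t' d_term_def if_not_P[OF False] powi m n .
qed

section \<open>The wirelength\<close>

theorem mainTheorem2:
  fixes p n n1 k :: nat
    and G :: "nat ugraph"
    and H :: "(nat \<times> bool list option) ugraph"
    and f :: "nat \<Rightarrow> nat \<times> bool list option"
    and P :: "nat set \<Rightarrow> (nat \<times> bool list option) list"
  assumes "p \<ge> 2" and "n \<ge> 2" and "n1 \<ge> 1" and "p \<le> n" and "n1 \<le> n"
    and "k = 2 ^ (n - n1)"
    and "G = residue_multipartite n p"
    and "H = k_rooted_tree n1 k"
    and "f = vertex_labeled n1"
    and "shortest_routing G H f P"
  shows "is_embedding G H f P \<and>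
         (\<forall>g Q. is_embedding G H g Q \<longrightarrow>
            embedding_wirelength G P \<le> embedding_wirelength G Q) \<and>
         (p \<le> n1 \<or> p = n \<longrightarrow> real (wirelength G H) = closed_form n p n1 k)"
proof -
  have size: "k * 2 ^ n1 = 2 ^ n"
    using assms(5,6) by (simp flip: power_add)
  have V: "verts G = {1..2 ^ n}"
    by (simp add: assms(7) residue_multipartite_def complete_multipartite_def)
  have G: "simple_graph G"
    unfolding assms(7) residue_multipartite_def by (rule simple_graph_complete_multipartite) simp
  have f: "bij_betw f (verts G) (verts H)"
    using bij_vertex_labeled[of n1 k] by (simp add: V size assms(8,9))
  interpret cut_distance H "verts H" "descendants n1 k"
    unfolding assms(8) using assms(3) by (rule cut_distance_k_rooted_tree)
  let ?pre = "\<lambda>g c. {z \<in> verts G. g z \<in> descendants n1 k c}"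
  let ?min = "\<lambda>c. min_boundary n p (card (descendants n1 k c))"

  have card_pre: "card (?pre g c) = card (descendants n1 k c)"
    if g: "bij_betw g (verts G) (verts H)" and c: "c \<in> verts H" for g c
  proof -
    have "descendants n1 k c \<subseteq> verts H"
      using c unfolding assms(8) by (rule descendants_subset_verts)
    then have "descendants n1 k c = g ` verts G \<inter> descendants n1 k c"
      using g by (auto simp: bij_betw_def)
    also have "\<dots> = g ` ?pre g c"
      by auto
    finally have "g ` ?pre g c = descendants n1 k c" ..
    moreover have "inj_on g (?pre g c)"
      using g by (auto simp: bij_betw_def inj_on_def)
    ultimately show ?thesis
      using card_image by metis
  qed

  have embedding: "is_embedding G H f P"
    unfolding is_embedding_def
  proof (intro conjI ballI)
    show "inj_on f (verts G)" "f ` verts G \<subseteq> verts H"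
      using f by (simp_all add: bij_betw_def)
    fix e assume "e \<in> edges G"
    then have "\<exists>x y. e = {x, y} \<and> shortest_path_between H (f x) (f y) (P e)"
      using assms(10) by (simp add: shortest_routing_def)
    then show "\<exists>x y. e = {x, y} \<and> path_between H (f x) (f y) (P e)"
      by (auto simp: shortest_path_between_def)
  qed

  have "int (card (boundary G (?pre f c))) = ?min c" if c: "c \<in> verts H" for c
  proof -
    obtain a s where interval: "?pre f c = {a..<a + s}"
      using descendants_interval[of c n1 k] c by (auto simp: V size assms(8,9))
    then have "{a..<a + s} \<subseteq> {1..2 ^ n}"
      using V by blast
    then have "int (card (boundary G (?pre f c))) = min_boundary n p s"
      unfolding interval unfolding assms(7) by (rule card_boundary_interval[OF assms(4)])
    then show ?thesis
      using card_pre[OF f c] interval by simp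
  qed
  then have wirelength_P: "int (embedding_wirelength G P) = (\<Sum>c\<in>verts H. ?min c)"
    unfolding wirelength_shortest_routing[OF G assms(10)] by simp

  have optimal: "embedding_wirelength G P \<le> embedding_wirelength G Q"
    if Q: "is_embedding G H g Q" for g Q
  proof -
    have "card (verts G) = card (verts H)"
      using f by (rule bij_betw_same_card)
    then have g: "bij_betw g (verts G) (verts H)"
      using Q finite_cuts unfolding is_embedding_def bij_betw_def
      by (metis card_image card_subset_eq)
    have "?min c \<le> int (card (boundary G (?pre g c)))" if "c \<in> verts H" for c
    proof -
      have "?pre g c \<subseteq> {1..2 ^ n}"
        using V by blast
      then show ?thesis
        using min_boundary_le[OF assms(4), folded assms(7)] card_pre[OF g that] by metis
    qed
    then have "(\<Sum>c\<in>verts H. ?min c) \<le> int (\<Sum>c\<in>verts H. card (boundary G (?pre g c)))"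
      by (simp add: sum_mono)
    also have "\<dots> \<le> int (embedding_wirelength G Q)"
      using sum_boundaries_le_wirelength[OF G Q] by (simp only: of_nat_le_iff)
    finally show ?thesis
      using wirelength_P by simp
  qed

  have "real (wirelength G H) = closed_form n p n1 k" if exact: "p \<le> n1 \<or> p = n"
  proof -
    let ?h = "\<lambda>s. real_of_int (min_boundary n p s)"
    have "wirelength G H = embedding_wirelength G P"
      unfolding wirelength_def
      by (rule Least_equality) (use embedding optimal in blast)+
    then have "real (wirelength G H) = (\<Sum>c\<in>verts H. ?h (card (descendants n1 k c)))"
      using arg_cong[OF wirelength_P, of real_of_int] by simp
    also have "\<dots> = real k * (\<Sum>j = 1..n1. 2 ^ (n1 - j) * ?h (2 ^ j - 1)) + (\<Sum>i = 1..k. ?h (i * 2 ^ n1))"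
      unfolding assms(8) by (rule sum_verts_k_rooted_tree)
    also have "(\<Sum>j = 1..n1. 2 ^ (n1 - j) * ?h (2 ^ j - 1))
        = (\<Sum>j = 1..n1. \<Sum>i = 1..(2::nat) ^ (n1 - j). c_term n p j)"
      using min_boundary_subtree[OF assms(4)] by (intro sum.cong) simp_all
    also have "(\<Sum>i = 1..k. ?h (i * 2 ^ n1)) = (\<Sum>i = 1..k - 1. ?h (i * 2 ^ n1)) + ?h (k * 2 ^ n1)"
    proof -
      obtain k' where "k = Suc k'"
        using assms(6) by (metis not0_implies_Suc power_eq_0_iff zero_neq_numeral)
      then show ?thesis
        by simp
    qed
    also have "?h (k * 2 ^ n1) = 0"
      unfolding size by (rule min_boundary_all[OF assms(4)])
    also have "(\<Sum>i = 1..k - 1. ?h (i * 2 ^ n1)) = (\<Sum>i = 1..k - 1. d_term n p n1 i)"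
    proof (rule sum.cong)
      fix i assume "i \<in> {1..k - 1}"
      then have "i * 2 ^ n1 < k * 2 ^ n1"
        by auto
      then show "?h (i * 2 ^ n1) = d_term n p n1 i"
        using min_boundary_copies[OF assms(4) _ exact] size by simp
    qed simp
    finally show ?thesis
      by (simp add: closed_form_def)
  qed
  with embedding optimal show ?thesis
    by blast
qed

end
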